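(* For all integers $d\ge 1$ and $n\ge 0$, the map $\mathrm{mx}:\mathrm{dA}_n\to \mathrm{dMtx}_n$ is a bijection. Consequently $|\mathrm{dA}_n|=|\mathrm{dMtx}_n|$.
   Context: $d$-ascent sequences. For a sequence $\alpha=a_1a_2\ldots a_n$ of nonnegative integers and an integer $d\ge 0$, an index $k\in\{1,\dots,n-1\}$ is a $d$-ascent of $\alpha$ if $a_{k+1}>a_k-d$; $\mathrm{dasc}\,\alpha$ denotes the number of $d$-ascents of $\alpha$. Write $\alpha_k=a_1\ldots a_k$ for the prefix of length $k$. The sequence $\alpha$ is a $d$-ascent sequence if $a_1=0$ and $a_{k+1}\le 1+\mathrm{dasc}\,\alpha_k$ for all $k\in\{1,\dots,n-1\}$. $\mathrm{dA}_n$ is the set of $d$-ascent sequences of length $n$ ($\mathrm{dA}_0$ consists of the empty sequence). $d$-matrices ($d\ge1$). Rows and columns of square matrices are indexed by $0,1,\dots,m$ with $m\ge -1$ ($m=-1$ being the empty matrix). For a matrix $M$ let $c_j$ be its $j$th column; if $c_j\ne 0$, let $\mathrm{rmin}\,c_j$ and $\mathrm{rmax}\,c_j$ be the smallest and largest row index of a nonzero entry of $c_j$. A $d$-matrix is a matrix $M$ with rows and columns indexed by $\{0,\dots,m\}$, for some $m\ge -1$, such that: (M1) $M$ is upper triangular (diagonal entries allowed to be nonzero) with entries in $\{0,1\}$; (M2) between any two ones in the same column there are at least $d-1$ zeros; (M3) $M$ has no zero columns and $\mathrm{rmax}\,c_j>\mathrm{rmin}\,c_{j-1}-d$ for all $j\in\{1,\dots,m\}$.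 $\mathrm{dMtx}_n$ is the set of $d$-matrices with exactly $n$ ones. The map $\mathrm{mx}$. Given $\alpha=a_1\ldots a_n\in \mathrm{dA}_n$, write $\alpha=\delta_0\delta_1\cdots\delta_m$ as the concatenation of factors obtained by dividing $\alpha$ after each $d$-ascent (i.e. between $a_k$ and $a_{k+1}$ for each $d$-ascent $k$); equivalently the $\delta_i$ are the maximal factors of $\alpha$ containing no $d$-ascent (for the empty sequence $m=-1$). Let $E_{i,j}$ be the $\{0,\dots,m\}\times\{0,\dots,m\}$ matrix whose only nonzero entry is a $1$ in position $(i,j)$. Let $M_0$ be the zero matrix with rows and columns indexed by $\{0,\dots,m\}$, let $M_k=M_{k-1}+E_{a_k,j}$ for $1\le k\le n$, where $j$ is the index such that the entry $a_k$ lies in the factor $\delta_j$, and set $\mathrm{mx}(\alpha)=M_n$. *)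

theory Defs
  imports "Jordan_Normal_Form.Matrix"
begin

text \<open>A sequence a_1 ... a_n is a \<^typ>\<open>nat list\<close>, so a_k is \<open>\<alpha> ! (k - 1)\<close>. Positions \<open>k\<close> are
  1-based. The difference a_k - d may be negative and is therefore taken in the
  integers.\<close>

definition dascents :: "nat \<Rightarrow> nat list \<Rightarrow> nat set" where
  "dascents d \<alpha> = {k. 1 \<le> k \<and> k < length \<alpha> \<and> int (\<alpha> ! k) > int (\<alpha> ! (k - 1)) - int d}"

definition dasc :: "nat \<Rightarrow> nat list \<Rightarrow> nat" where
  "dasc d \<alpha> = card (dascents d \<alpha>)"

definition dascent_seq :: "nat \<Rightarrow> nat list \<Rightarrow> bool" where
  "dascent_seq d \<alpha> \<longleftrightarrow>
     \<alpha> = [] \<or> (\<alpha> ! 0 = 0 \<and> (\<forall>k\<in>{1..<length \<alpha>}. \<alpha> ! k \<le> 1 + dasc d (take k \<alpha>)))"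

definition dA :: "nat \<Rightarrow> nat \<Rightarrow> nat list set" where
  "dA d n = {\<alpha>. length \<alpha> = n \<and> dascent_seq d \<alpha>}"

text \<open>Rows and columns \<open>0, \<dots>, m\<close> with \<open>m \<ge> -1\<close> become an \<open>N\<close> by \<open>N\<close> matrix with
  \<open>N = m + 1 \<ge> 0\<close>. Both \<open>rmin\<close> and \<open>rmax\<close> are only meaningful for nonzero vectors.\<close>

definition rmin :: "int vec \<Rightarrow> nat" where
  "rmin v = Min {i. i < dim_vec v \<and> v $ i \<noteq> 0}"

definition rmax :: "int vec \<Rightarrow> nat" where
  "rmax v = Max {i. i < dim_vec v \<and> v $ i \<noteq> 0}"

text \<open>The difference \<open>d - 1\<close> is truncated for \<open>d = 0\<close>; d-matrices are only considered for \<open>d \<ge> 1\<close>.\<close>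

definition d_matrix :: "nat \<Rightarrow> int mat \<Rightarrow> bool" where
  "d_matrix d M \<longleftrightarrow>
     square_mat M \<and>
     upper_triangular M \<and>
     (\<forall>i<dim_row M. \<forall>j<dim_col M. M $$ (i, j) \<in> {0, 1}) \<and>
     (\<forall>j<dim_col M. \<forall>i<dim_row M. \<forall>i'<dim_row M.
        i < i' \<longrightarrow> M $$ (i, j) = 1 \<longrightarrow> M $$ (i', j) = 1 \<longrightarrow>
        d - 1 \<le> card {r. i < r \<and> r < i' \<and> M $$ (r, j) = 0}) \<and>
     (\<forall>j<dim_col M. col M j \<noteq> 0\<^sub>v (dim_row M)) \<and>
     (\<forall>j\<in>{1..<dim_col M}. int (rmax (col M j)) > int (rmin (col M (j - 1))) - int d)"

definition dMtx :: "nat \<Rightarrow> nat \<Rightarrow> int mat set" where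
  "dMtx d n = {M. d_matrix d M \<and>
     card {(i, j). i < dim_row M \<and> j < dim_col M \<and> M $$ (i, j) = 1} = n}"

text \<open>\<open>factors d \<alpha>\<close> is the list of the factors obtained by dividing \<open>\<alpha>\<close> after each d-ascent. In the
  last equation the first two entries \<open>x, y\<close> are separated if they form a d-ascent; otherwise \<open>x\<close>
  joins the factor starting with \<open>y\<close>.\<close>

fun factors :: "nat \<Rightarrow> nat list \<Rightarrow> nat list list" where
  "factors d [] = []"
| "factors d [x] = [[x]]"
| "factors d (x # y # ys) =
     (if int y > int x - int d then [x] # factors d (y # ys)
      else (x # hd (factors d (y # ys))) # tl (factors d (y # ys)))"

text \<open>\<open>k\<close> is again a 1-based position; the description is only meaningful for
  \<open>1 \<le> k \<le> length \<alpha>\<close>.\<close>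

definition factor_index :: "nat \<Rightarrow> nat list \<Rightarrow> nat \<Rightarrow> nat" where
  "factor_index d \<alpha> k = (THE j. j < length (factors d \<alpha>) \<and>
     length (concat (take j (factors d \<alpha>))) < k \<and>
     k \<le> length (concat (take (Suc j) (factors d \<alpha>))))"

text \<open>The index of \<open>E_mat\<close> is out of range, and the summand then zero, only if a_k is not at most m,
  which does not happen for d-ascent sequences.\<close>

definition E_mat :: "nat \<Rightarrow> nat \<Rightarrow> nat \<Rightarrow> int mat" where
  "E_mat N i j = mat N N (\<lambda>(r, c). if r = i \<and> c = j then 1 else 0)"

fun mx_partial :: "nat \<Rightarrow> nat list \<Rightarrow> nat \<Rightarrow> int mat" where
  "mx_partial d \<alpha> 0 = 0\<^sub>m (length (factors d \<alpha>)) (length (factors d \<alpha>))"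
| "mx_partial d \<alpha> (Suc k) =
     mx_partial d \<alpha> k + E_mat (length (factors d \<alpha>)) (\<alpha> ! k) (factor_index d \<alpha> (Suc k))"

definition mx :: "nat \<Rightarrow> nat list \<Rightarrow> int mat" where
  "mx d \<alpha> = mx_partial d \<alpha> (length \<alpha>)"

end

theory Submission
  imports Defs
begin

text \<open>The matrix of a sequence \<open>\<alpha>\<close> is best seen as a picture of its list of factors. A factor has no
  d-ascent, so each of its entries is at least \<open>d\<close> below the preceding one. As \<open>d \<ge> 1\<close>, a factor is
  strictly decreasing: it can be recovered from its set of entries, with its first entry as the
  maximum and its last entry as the minimum. The \<open>j\<close>th column of \<open>mx d \<alpha>\<close> is the indicator vector
  of that set (\<open>mx_eq_incidence_mat\<close>). The defining properties of the two classes then correspond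
  one by one:

  \<^item> The gap \<open>d\<close> between consecutive entries of a factor is the condition on the zeros between two
    ones of a column (\<open>gap_iff_zeros_between\<close>).

  \<^item> The d-ascent between two consecutive factors compares the last entry of one with the first
    entry of the next, which are \<open>rmin\<close> and \<open>rmax\<close> of the two columns
    (\<open>d_matrix_incidence_mat_iff\<close>).

  \<^item> The growth condition of d-ascent sequences says that the entries of the factor with index \<open>j\<close>
    are at most \<open>j\<close>, which is upper triangularity (\<open>dascent_seq_iff_subdiagonal\<close>). Indeed, for
    \<open>j \<ge> 1\<close> the prefix before that factor has \<open>j - 1\<close> d-ascents, so the bound for the first entry of
    the factor is \<open>j\<close>; the later entries are smaller, and the growth condition allows them even
    \<open>j + 1\<close>.

  Conversely, a list of runs separated by d-ascents is the list of factors of its concatenation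
  (\<open>factors_concat\<close>), so reading the rows of the ones column by column, each column from bottom to
  top, inverts \<open>mx\<close>.\<close>

section \<open>Factorizations into runs\<close>

text \<open>The intrinsic description of the lists \<open>fs\<close> that arise as \<open>factors d \<alpha>\<close>. The gap relation is
  required of all pairs in a run, not only of neighbours; this is the same, since the relation is
  transitive.\<close>

definition run_factorization :: "nat \<Rightarrow> nat list list \<Rightarrow> bool" where
  "run_factorization d fs \<longleftrightarrow>
     (\<forall>f\<in>set fs. f \<noteq> [] \<and> sorted_wrt (\<lambda>x y. y + d \<le> x) f) \<and>
     successively (\<lambda>f g. last f < hd g + d) fs"

definition subdiagonal :: "nat list list \<Rightarrow> bool" where
  "subdiagonal fs \<longleftrightarrow> (\<forall>j<length fs. \<forall>x\<in>set (fs ! j). x \<le> j)"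

lemma factors_eq_Nil_iff [simp]: "factors d \<alpha> = [] \<longleftrightarrow> \<alpha> = []"
  by (induction d \<alpha> rule: factors.induct) auto

lemma hd_hd_factors: "\<alpha> \<noteq> [] \<Longrightarrow> hd (factors d \<alpha>) \<noteq> [] \<and> hd (hd (factors d \<alpha>)) = hd \<alpha>"
  by (induction d \<alpha> rule: factors.induct) auto

lemma concat_factors [simp]: "concat (factors d \<alpha>) = \<alpha>"
proof (induction d \<alpha> rule: factors.induct)
  case (3 d x y ys)
  have "factors d (y # ys) = hd (factors d (y # ys)) # tl (factors d (y # ys))" by simp
  then have "hd (factors d (y # ys)) @ concat (tl (factors d (y # ys))) = y # ys"
    using 3 by (metis concat.simps(2))
  then show ?case using 3 by auto
qed auto

lemma run_factorization_factors: "run_factorization d (factors d \<alpha>)"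
proof (induction d \<alpha> rule: factors.induct)
  case (3 d x y ys)
  define F where "F = factors d (y # ys)"
  have F: "run_factorization d F" using 3 unfolding F_def by metis
  obtain g gs where Fg: "F = g # gs" by (metis F_def factors_eq_Nil_iff list.distinct(1) neq_Nil_conv)
  have g: "g \<noteq> []" "hd g = y" using hd_hd_factors[of "y # ys" d] Fg F_def by auto
  then obtain g' where g': "g = y # g'" by (metis list.collapse)
  show ?case
  proof (cases "int y > int x - int d")
    case True
    then show ?thesis using F g
      by (auto simp: F_def[symmetric] Fg run_factorization_def)
  next
    case False
    then show ?thesis using F
      by (force simp: F_def[symmetric] Fg g' run_factorization_def successively_Cons)
  qed
qed (auto simp: run_factorization_def)

lemma factors_run_append:
  assumes "f \<noteq> []" "sorted_wrt (\<lambda>x y. y + d \<le> x) f" "\<beta> \<noteq> [] \<Longrightarrow> last f < hd \<beta> + d"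
  shows "factors d (f @ \<beta>) = f # factors d \<beta>"
  using assms
proof (induction f rule: list_nonempty_induct)
  case (single x)
  then show ?case by (cases \<beta>) auto
next
  case (cons x xs)
  then obtain y ys where xs: "xs = y # ys" by (metis list.exhaust)
  have "factors d (xs @ \<beta>) = xs # factors d \<beta>" using cons by auto
  then show ?case using cons.prems xs by auto
qed

text \<open>The cuts of \<open>concat fs\<close> are forced: there is no d-ascent inside a run and there is one at
  the end of each run but the last.\<close>

lemma factors_concat:
  assumes "run_factorization d fs"
  shows "factors d (concat fs) = fs"
  using assms
proof (induction fs)
  case (Cons f fs)
  have ne: "\<forall>g\<in>set (f # fs). g \<noteq> []" using Cons.prems by (auto simp: run_factorization_def)
  have "last f < hd (concat fs) + d" if ne': "concat fs \<noteq> []"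
  proof -
    obtain g gs where "fs = g # gs" using ne' by (cases fs) auto
    then show ?thesis using Cons.prems ne by (auto simp: run_factorization_def)
  qed
  moreover have "run_factorization d fs"
    using Cons.prems by (auto simp: run_factorization_def successively_Cons)
  ultimately show ?case
    using Cons.prems Cons.IH factors_run_append[of f d "concat fs"]
    by (simp add: run_factorization_def del: concat_eq_Nil_conv)
qed simp

section \<open>The growth condition\<close>

text \<open>The growth condition bounds each entry in terms of the prefix before it, so it is compared
  with the factorization by induction on prefixes, whereas the equations of \<open>factors\<close> recurse on
  suffixes.\<close>

lemma factors_snoc:
  assumes "\<alpha> \<noteq> []"
  shows "factors d (\<alpha> @ [z]) =
    (if last \<alpha> < z + d then factors d \<alpha> @ [[z]]
     else butlast (factors d \<alpha>) @ [last (factors d \<alpha>) @ [z]])"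
  using assms
proof (induction d \<alpha> rule: factors.induct)
  case (3 d x y ys)
  define F where "F = factors d (y # ys)"
  have IH: "factors d (y # ys @ [z]) =
      (if last (y # ys) < z + d then F @ [[z]] else butlast F @ [last F @ [z]])"
    using 3 unfolding F_def by (metis append_Cons list.distinct(1))
  obtain g gs where Fg: "F = g # gs" by (metis F_def factors_eq_Nil_iff list.distinct(1) neq_Nil_conv)
  show ?case using Fg by (auto simp: IH F_def[symmetric])
qed auto

lemma last_last_factors:
  assumes "\<alpha> \<noteq> []"
  shows "last (last (factors d \<alpha>)) = last \<alpha>" "last (factors d \<alpha>) \<noteq> []"
proof -
  have ne: "factors d \<alpha> \<noteq> []" using assms by simp
  show 1: "last (factors d \<alpha>) \<noteq> []"
    using run_factorization_factors[of d \<alpha>] last_in_set[OF ne] by (auto simp: run_factorization_def)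
  have "\<alpha> = concat (butlast (factors d \<alpha>)) @ last (factors d \<alpha>)"
    using append_butlast_last_id[OF ne] concat_append[of "butlast (factors d \<alpha>)" "[last (factors d \<alpha>)]"]
    by simp
  then show "last (last (factors d \<alpha>)) = last \<alpha>" using 1 by (metis last_appendR)
qed

lemma dasc_snoc:
  assumes "\<alpha> \<noteq> []"
  shows "dasc d (\<alpha> @ [x]) = dasc d \<alpha> + (if last \<alpha> < x + d then 1 else 0)"
proof -
  have "dascents d (\<alpha> @ [x]) = dascents d \<alpha> \<union> (if last \<alpha> < x + d then {length \<alpha>} else {})"
    using assms by (auto simp: dascents_def nth_append last_conv_nth less_Suc_eq)
  moreover have "finite (dascents d \<alpha>)" "length \<alpha> \<notin> dascents d \<alpha>"
    by (auto simp: dascents_def)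
  ultimately show ?thesis by (simp add: dasc_def)
qed

lemma length_factors: "\<alpha> \<noteq> [] \<Longrightarrow> length (factors d \<alpha>) = 1 + dasc d \<alpha>"
proof (induction \<alpha> rule: rev_induct)
  case (snoc x \<alpha>)
  show ?case
  proof (cases "\<alpha> = []")
    case True
    then show ?thesis by (simp add: dasc_def dascents_def)
  next
    case False
    then show ?thesis using snoc by (simp add: factors_snoc dasc_snoc)
  qed
qed simp

lemma dascent_seq_snoc:
  "dascent_seq d (\<alpha> @ [x]) \<longleftrightarrow>
    (if \<alpha> = [] then x = 0 else dascent_seq d \<alpha> \<and> x \<le> 1 + dasc d \<alpha>)"
proof (cases "\<alpha> = []")
  case False
  then have "{1..<length (\<alpha> @ [x])} = insert (length \<alpha>) {1..<length \<alpha>}"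
    by (cases \<alpha>) auto
  then show ?thesis using False by (auto simp: dascent_seq_def nth_append)
qed (simp add: dascent_seq_def)

lemma subdiagonal_snoc: "subdiagonal (fs @ [f]) \<longleftrightarrow> subdiagonal fs \<and> (\<forall>x\<in>set f. x \<le> length fs)"
  by (auto simp: subdiagonal_def nth_append less_Suc_eq all_conj_distrib)

text \<open>Appending \<open>x\<close> to \<open>\<alpha>\<close> at a d-ascent opens a factor with index \<open>length (factors d \<alpha>)\<close>, which
  by \<open>length_factors\<close> is exactly the bound that the growth condition puts on \<open>x\<close>. Otherwise \<open>x\<close> is
  at most \<open>last \<alpha>\<close>, which lies in the same factor, and both conditions on \<open>x\<close> hold automatically.\<close>

lemma dascent_seq_iff_subdiagonal: "dascent_seq d \<alpha> \<longleftrightarrow> subdiagonal (factors d \<alpha>)"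
proof (induction \<alpha> rule: rev_induct)
  case Nil
  then show ?case by (simp add: dascent_seq_def subdiagonal_def)
next
  case (snoc x \<alpha>)
  show ?case
  proof (cases "\<alpha> = []")
    case True
    then show ?thesis by (simp add: dascent_seq_def subdiagonal_def)
  next
    case False
    define F where "F = factors d \<alpha>"
    have F: "F \<noteq> []" "last F \<noteq> []" "last (last F) = last \<alpha>" "length F = 1 + dasc d \<alpha>"
      using False last_last_factors[OF False] length_factors[OF False] by (auto simp: F_def)
    have split: "subdiagonal F \<longleftrightarrow>
        subdiagonal (butlast F) \<and> (\<forall>y\<in>set (last F). y \<le> dasc d \<alpha>)"
      using F subdiagonal_snoc[of "butlast F" "last F"] by simp
    show ?thesis
    proof (cases "last \<alpha> < x + d")
      case True
      then show ?thesis using False snoc F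
        by (simp add: dascent_seq_snoc factors_snoc subdiagonal_snoc F_def[symmetric])
    next
      case nasc: False
      have "last \<alpha> \<le> dasc d \<alpha>" if "subdiagonal F"
        using that split F by (metis last_in_set)
      then have "x \<le> dasc d \<alpha>" if "subdiagonal F" using that nasc by fastforce
      then show ?thesis using False nasc snoc F split
        by (auto simp: dascent_seq_snoc factors_snoc subdiagonal_snoc F_def[symmetric])
    qed
  qed
qed

section \<open>The matrix of a factorization\<close>

text \<open>An entry of \<open>fs ! j\<close> that is not below \<open>length fs\<close> leaves no trace in the matrix; subdiagonal
  lists have no such entries.\<close>

definition incidence_mat :: "nat list list \<Rightarrow> int mat" where
  "incidence_mat fs =
     mat (length fs) (length fs) (\<lambda>(i, j). if i \<in> set (fs ! j) then 1 else 0)"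

lemma nth_concat_offset:
  assumes "j < length fs" "q < length (fs ! j)"
  shows "concat fs ! (length (concat (take j fs)) + q) = fs ! j ! q"
proof -
  have "concat fs = concat (take j fs) @ fs ! j @ concat (drop (Suc j) fs)"
    by (metis assms(1) concat.simps(2) concat_append id_take_nth_drop)
  then show ?thesis using assms(2) by (metis nth_append nth_append_length_plus)
qed

lemma length_concat_take_Suc:
  "j < length fs \<Longrightarrow>
     length (concat (take (Suc j) fs)) = length (concat (take j fs)) + length (fs ! j)"
  by (simp add: take_Suc_conv_app_nth)

lemma length_concat_take_mono:
  assumes "i \<le> j"
  shows "length (concat (take i fs)) \<le> length (concat (take j fs))"
proof -
  have "take j fs = take i fs @ take (j - i) (drop i fs)"
    using assms by (metis le_add_diff_inverse take_add)
  then show ?thesis by simp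
qed

text \<open>The offsets \<open>length (concat (take j fs))\<close> cut the positions of \<open>concat fs\<close> into disjoint
  intervals, so the definite description in \<open>factor_index\<close> is met by exactly one index.\<close>

lemma factor_index_eq_iff:
  assumes "p < length \<alpha>" "c < length (factors d \<alpha>)"
  shows "factor_index d \<alpha> (Suc p) = c \<longleftrightarrow>
    length (concat (take c (factors d \<alpha>))) \<le> p \<and>
    p < length (concat (take (Suc c) (factors d \<alpha>)))"
proof -
  define F where "F = factors d \<alpha>"
  define off where "off j = length (concat (take j F))" for j
  define P where "P j \<longleftrightarrow> j < length F \<and> off j < Suc p \<and> Suc p \<le> off (Suc j)" for j
  have total: "off (length F) = length \<alpha>" by (simp add: off_def F_def)
  define j where "j = (LEAST j. Suc p \<le> off (Suc j))"
  have "Suc (length F - 1) = length F" using assms(2) F_def by simp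
  (* The last offset is length \<alpha>, so some interval reaches beyond p; j is the first one that does. *)
  then have ex: "Suc p \<le> off (Suc (length F - 1))" using assms(1) total by simp
  have j1: "Suc p \<le> off (Suc j)" unfolding j_def by (rule LeastI) (rule ex)
  have j2: "j \<le> length F - 1" unfolding j_def by (rule Least_le) (rule ex)
  have "off j < Suc p"
  proof (cases j)
    case 0
    then show ?thesis by (simp add: off_def)
  next
    case (Suc i)
    have "i < (LEAST j. Suc p \<le> off (Suc j))" using Suc j_def by simp
    then have "\<not> Suc p \<le> off (Suc i)" by (rule not_less_Least)
    then show ?thesis using Suc by simp
  qed
  moreover have "j < length F" using j2 assms(2) unfolding F_def by linarith
  ultimately have Pj: "P j" using j1 by (simp add: P_def)
  have uniq: "a = b" if "P a" "P b" for a b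
  proof (rule ccontr)
    assume "a \<noteq> b"
    then consider "Suc a \<le> b" | "Suc b \<le> a" by linarith
    then show False
    proof cases
      case 1
      then have "off (Suc a) \<le> off b" unfolding off_def by (rule length_concat_take_mono)
      then show False using that by (auto simp: P_def)
    next
      case 2
      then have "off (Suc b) \<le> off a" unfolding off_def by (rule length_concat_take_mono)
      then show False using that by (auto simp: P_def)
    qed
  qed
  have fi: "factor_index d \<alpha> (Suc p) = (THE j. P j)"
    by (simp only: factor_index_def P_def off_def F_def)
  have "factor_index d \<alpha> (Suc p) = c \<longleftrightarrow> P c"
    unfolding fi using Pj uniq by (metis the_equality)
  also have "P c \<longleftrightarrow> off c \<le> p \<and> p < off (Suc c)"
    using assms(2) by (auto simp: P_def F_def)
  finally show ?thesis by (simp only: off_def F_def)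
qed

lemma mx_partial_dim [simp]:
  "dim_row (mx_partial d \<alpha> k) = length (factors d \<alpha>)"
  "dim_col (mx_partial d \<alpha> k) = length (factors d \<alpha>)"
  by (induction k) (auto simp: E_mat_def)

text \<open>The sum of the matrices \<open>E_mat\<close> counts positions, hence repeated entries in a factor would give
  matrix entries larger than 1. For \<open>d \<ge> 1\<close> the factors are strictly decreasing, so this
  does not happen.\<close>

lemma mx_partial_entry:
  assumes "r < length (factors d \<alpha>)" "c < length (factors d \<alpha>)"
  shows "mx_partial d \<alpha> k $$ (r, c) =
    int (card {p. p < k \<and> \<alpha> ! p = r \<and> factor_index d \<alpha> (Suc p) = c})"
proof (induction k)
  case (Suc k)
  let ?S = "\<lambda>k. {p. p < k \<and> \<alpha> ! p = r \<and> factor_index d \<alpha> (Suc p) = c}"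
  have "?S (Suc k) = (if \<alpha> ! k = r \<and> factor_index d \<alpha> (Suc k) = c then insert k (?S k) else ?S k)"
    by (auto simp: less_Suc_eq)
  then have "int (card (?S (Suc k))) =
      int (card (?S k)) + (if \<alpha> ! k = r \<and> factor_index d \<alpha> (Suc k) = c then 1 else 0)"
    by simp
  moreover have "mx_partial d \<alpha> (Suc k) $$ (r, c) =
      mx_partial d \<alpha> k $$ (r, c) + E_mat (length (factors d \<alpha>)) (\<alpha> ! k) (factor_index d \<alpha> (Suc k)) $$ (r, c)"
    using assms by (simp add: E_mat_def)
  moreover have "E_mat (length (factors d \<alpha>)) (\<alpha> ! k) (factor_index d \<alpha> (Suc k)) $$ (r, c) =
      (if \<alpha> ! k = r \<and> factor_index d \<alpha> (Suc k) = c then 1 else 0)"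
    using assms by (auto simp: E_mat_def)
  ultimately show ?case using Suc by simp
qed (use assms in simp)

lemma sorted_wrt_gap_greater:
  fixes d :: nat
  assumes "d \<ge> 1" "sorted_wrt (\<lambda>x y. y + d \<le> x) f"
  shows "sorted_wrt (>) f"
  using assms by (auto intro: sorted_wrt_mono_rel[rotated])

lemma distinct_if_sorted_wrt_greater:
  fixes f :: "nat list"
  shows "sorted_wrt (>) f \<Longrightarrow> distinct f"
  by (induction f) auto

lemma card_nth_eq_distinct:
  assumes "distinct f"
  shows "card {q. q < length f \<and> f ! q = r} = (if r \<in> set f then 1 else 0)"
proof (cases "r \<in> set f")
  case True
  then obtain q where "q < length f" "f ! q = r" by (auto simp: in_set_conv_nth)
  then have "{q. q < length f \<and> f ! q = r} = {q}"
    using assms by (auto simp: distinct_conv_nth)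
  then show ?thesis using True by simp
next
  case False
  then have "{q. q < length f \<and> f ! q = r} = {}" by auto
  then show ?thesis using False by (simp only: card.empty if_False)
qed

lemma mx_eq_incidence_mat:
  assumes "d \<ge> 1"
  shows "mx d \<alpha> = incidence_mat (factors d \<alpha>)"
proof (rule eq_matI)
  define F where "F = factors d \<alpha>"
  fix r c
  assume rc': "r < dim_row (incidence_mat (factors d \<alpha>))" "c < dim_col (incidence_mat (factors d \<alpha>))"
  then have rc: "r < length F" "c < length F" by (auto simp: incidence_mat_def F_def)
  define off where "off = length (concat (take c F))"
  have off': "length (concat (take (Suc c) F)) = off + length (F ! c)"
    using rc by (simp add: off_def length_concat_take_Suc)
  have "off + length (F ! c) \<le> length (concat (take (length F) F))"
    unfolding off'[symmetric] using rc by (intro length_concat_take_mono) simp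
  then have bound: "off + length (F ! c) \<le> length \<alpha>" by (simp add: F_def)
  have nth: "\<alpha> ! (off + q) = F ! c ! q" if "q < length (F ! c)" for q
    using nth_concat_offset[of c F q] that rc by (simp add: off_def F_def)
  (* Positions counted for column c are those of the interval that F ! c occupies in \<alpha>. *)
  have "{p. p < length \<alpha> \<and> \<alpha> ! p = r \<and> factor_index d \<alpha> (Suc p) = c} =
      {p. p < length \<alpha> \<and> \<alpha> ! p = r \<and> off \<le> p \<and> p < off + length (F ! c)}"
    using factor_index_eq_iff[of _ \<alpha> c d] rc off' unfolding F_def off_def by auto
  also have "\<dots> = (\<lambda>q. off + q) ` {q. q < length (F ! c) \<and> F ! c ! q = r}"
  proof (intro equalityI subsetI)
    fix p assume p: "p \<in> {p. p < length \<alpha> \<and> \<alpha> ! p = r \<and> off \<le> p \<and> p < off + length (F ! c)}"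
    then have "p = off + (p - off)" "p - off < length (F ! c)" by auto
    then show "p \<in> (\<lambda>q. off + q) ` {q. q < length (F ! c) \<and> F ! c ! q = r}"
      using p nth[of "p - off"] by (intro image_eqI[of _ _ "p - off"]) auto
  qed (use bound nth in auto)
  finally have "card {p. p < length \<alpha> \<and> \<alpha> ! p = r \<and> factor_index d \<alpha> (Suc p) = c} =
      card {q. q < length (F ! c) \<and> F ! c ! q = r}"
    by (simp add: card_image)
  moreover have "distinct (F ! c)"
    using run_factorization_factors[of d \<alpha>] rc(2)
    by (intro distinct_if_sorted_wrt_greater sorted_wrt_gap_greater[OF assms])
      (auto simp: run_factorization_def F_def)
  ultimately have "mx d \<alpha> $$ (r, c) = (if r \<in> set (F ! c) then 1 else 0)"
    using rc by (simp add: mx_def mx_partial_entry card_nth_eq_distinct F_def)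
  then show "mx d \<alpha> $$ (r, c) = incidence_mat (factors d \<alpha>) $$ (r, c)"
    using rc by (simp add: incidence_mat_def F_def)
qed (auto simp: mx_def incidence_mat_def)

section \<open>Incidence matrices that are d-matrices\<close>

text \<open>From left to right, the \<open>d - 1\<close> rows directly below \<open>i\<close> (with larger index) are all zeros: a one
  among them would be too close to \<open>i\<close>. So the zeros are found even if further ones lie between \<open>i\<close>
  and \<open>i'\<close>. From right to left, there are at least as many rows as zeros between two ones.\<close>

lemma gap_iff_zeros_between:
  fixes d :: nat
  assumes "d \<ge> 1" "sorted_wrt (>) f"
  shows "sorted_wrt (\<lambda>x y. y + d \<le> x) f \<longleftrightarrow>
    (\<forall>i\<in>set f. \<forall>i'\<in>set f. i < i' \<longrightarrow> d - 1 \<le> card {r. i < r \<and> r < i' \<and> r \<notin> set f})"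
proof
  assume gap: "sorted_wrt (\<lambda>x y. y + d \<le> x) f"
  have far: "i + d \<le> i'" if "i \<in> set f" "i' \<in> set f" "i < i'" for i i'
    using gap that assms(1)
  proof (induction f)
    case (Cons a f)
    then show ?case by fastforce
  qed simp
  show "\<forall>i\<in>set f. \<forall>i'\<in>set f. i < i' \<longrightarrow> d - 1 \<le> card {r. i < r \<and> r < i' \<and> r \<notin> set f}"
  proof (intro ballI impI)
    fix i i' assume i: "i \<in> set f" "i' \<in> set f" "i < i'"
    have "{i<..<i + d} \<subseteq> {r. i < r \<and> r < i' \<and> r \<notin> set f}"
      using far[OF i] far[OF i(1)] by fastforce
    then have "card {i<..<i + d} \<le> card {r. i < r \<and> r < i' \<and> r \<notin> set f}"
      by (intro card_mono) auto
    then show "d - 1 \<le> card {r. i < r \<and> r < i' \<and> r \<notin> set f}" by simp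
  qed
next
  assume zeros: "\<forall>i\<in>set f. \<forall>i'\<in>set f. i < i' \<longrightarrow>
    d - 1 \<le> card {r. i < r \<and> r < i' \<and> r \<notin> set f}"
  show "sorted_wrt (\<lambda>x y. y + d \<le> x) f"
  proof (rule sorted_wrt_mono_rel[OF _ assms(2)])
    fix x y assume xy: "x \<in> set f" "y \<in> set f" "x > y"
    then have "d - 1 \<le> card {r. y < r \<and> r < x \<and> r \<notin> set f}" using zeros by blast
    also have "\<dots> \<le> card {y<..<x}" by (intro card_mono) auto
    finally show "y + d \<le> x" using xy assms(1) by simp
  qed
qed

lemma Max_Min_decreasing:
  fixes f :: "nat list"
  assumes "sorted_wrt (>) f" "f \<noteq> []"
  shows "Max (set f) = hd f" "Min (set f) = last f"
proof -
  show "Max (set f) = hd f" using assms by (intro Max_eqI) (cases f; auto)+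
  have "last f \<le> x" if "x \<in> set f" for x
    using assms that by (induction f) (auto split: if_splits, fastforce dest: last_in_set)
  then show "Min (set f) = last f" using assms by (intro Min_eqI) auto
qed

lemma incidence_mat_entry:
  "i < length fs \<Longrightarrow> j < length fs \<Longrightarrow>
     incidence_mat fs $$ (i, j) = (if i \<in> set (fs ! j) then 1 else 0)"
  by (simp add: incidence_mat_def)

lemma incidence_mat_dim [simp]:
  "dim_row (incidence_mat fs) = length fs" "dim_col (incidence_mat fs) = length fs"
  by (auto simp: incidence_mat_def)

lemma subdiagonal_less_length:
  "subdiagonal fs \<Longrightarrow> j < length fs \<Longrightarrow> x \<in> set (fs ! j) \<Longrightarrow> x < length fs"
  by (meson le_less_trans subdiagonal_def)

lemma support_col_incidence_mat:
  assumes "subdiagonal fs" "j < length fs"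
  shows "{i. i < dim_vec (col (incidence_mat fs) j) \<and> col (incidence_mat fs) j $ i \<noteq> 0} = set (fs ! j)"
proof -
  have "col (incidence_mat fs) j $ i \<noteq> 0 \<longleftrightarrow> i \<in> set (fs ! j)" if "i < length fs" for i
    using that assms(2) by (simp add: incidence_mat_entry)
  then show ?thesis using subdiagonal_less_length[OF assms] by auto
qed

text \<open>For a subdiagonal list the triangular shape and the 0-1 entries are given, so being a d-matrix
  reduces to the remaining conditions, which are read off the columns: gaps inside a run, nonempty
  runs, and d-ascents between neighbouring runs. Stating it as an equivalence lets the same lemma
  serve \<open>mx\<close> and its inverse.\<close>

lemma d_matrix_incidence_mat_iff:
  assumes "d \<ge> 1" "subdiagonal fs" "\<forall>f\<in>set fs. sorted_wrt (>) f"
  shows "d_matrix d (incidence_mat fs) \<longleftrightarrow> run_factorization d fs"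
proof -
  let ?M = "incidence_mat fs"
  let ?N = "length fs"
  note less = subdiagonal_less_length[OF assms(2)]
  have dec: "sorted_wrt (>) (fs ! j)" if "j < ?N" for j using assms(3) that by auto
  have "i \<notin> set (fs ! j)" if "i < ?N" "j < i" for i j
    using assms(2) that unfolding subdiagonal_def by (meson leD less_trans)
  then have tri: "upper_triangular ?M"
    by (simp add: upper_triangular_def incidence_mat_entry)
  have entries: "\<forall>i<dim_row ?M. \<forall>j<dim_col ?M. ?M $$ (i, j) \<in> {0, 1}"
    by (simp add: incidence_mat_entry)
  have m2: "(\<forall>i<?N. \<forall>i'<?N. i < i' \<longrightarrow> ?M $$ (i, j) = 1 \<longrightarrow> ?M $$ (i', j) = 1 \<longrightarrow>
        d - 1 \<le> card {r. i < r \<and> r < i' \<and> ?M $$ (r, j) = 0}) \<longleftrightarrow>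
      sorted_wrt (\<lambda>x y. y + d \<le> x) (fs ! j)" if j: "j < ?N" for j
  proof -
    have "{r. i < r \<and> r < i' \<and> ?M $$ (r, j) = 0} = {r. i < r \<and> r < i' \<and> r \<notin> set (fs ! j)}"
      if "i' < ?N" for i i' using that j by (auto simp: incidence_mat_entry)
    then show ?thesis
      unfolding gap_iff_zeros_between[OF assms(1) dec[OF j]]
      using j less[OF j] by (auto simp: incidence_mat_entry)
  qed
  have nz: "col ?M j \<noteq> 0\<^sub>v ?N \<longleftrightarrow> fs ! j \<noteq> []" if j: "j < ?N" for j
  proof -
    have "col ?M j = 0\<^sub>v ?N \<longleftrightarrow> (\<forall>i<?N. i \<notin> set (fs ! j))"
      using j by (auto simp: vec_eq_iff incidence_mat_entry)
    also have "\<dots> \<longleftrightarrow> fs ! j = []"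
      using less[OF j] by (metis empty_iff list.set(1) list.set_intros(1) neq_Nil_conv)
    finally show ?thesis by blast
  qed
  have rows: "rmax (col ?M j) = hd (fs ! j)" "rmin (col ?M j) = last (fs ! j)"
    if "j < ?N" "fs ! j \<noteq> []" for j
    using Max_Min_decreasing[OF dec that(2)] that
    by (simp_all only: rmax_def rmin_def support_col_incidence_mat[OF assms(2) that(1)])
  have m3: "int (rmax (col ?M j)) > int (rmin (col ?M (j - 1))) - int d \<longleftrightarrow>
      last (fs ! (j - 1)) < hd (fs ! j) + d"
    if "\<forall>j<?N. fs ! j \<noteq> []" "j \<in> {1..<?N}" for j
    using rows[of j] rows[of "j - 1"] that by auto
  have shift: "{1..<?N} = Suc ` {i. Suc i < ?N}"
    by (auto simp: image_iff Suc_le_eq gr0_conv_Suc)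
  have "d_matrix d ?M \<longleftrightarrow>
      (\<forall>j<?N. sorted_wrt (\<lambda>x y. y + d \<le> x) (fs ! j)) \<and> (\<forall>j<?N. fs ! j \<noteq> []) \<and>
      (\<forall>j\<in>{1..<?N}. int (rmax (col ?M j)) > int (rmin (col ?M (j - 1))) - int d)"
    using tri entries m2 nz unfolding d_matrix_def by simp
  also have "\<dots> \<longleftrightarrow>
      (\<forall>j<?N. sorted_wrt (\<lambda>x y. y + d \<le> x) (fs ! j)) \<and> (\<forall>j<?N. fs ! j \<noteq> []) \<and>
      (\<forall>j\<in>{1..<?N}. last (fs ! (j - 1)) < hd (fs ! j) + d)"
    using m3 by blast
  also have "(\<forall>j\<in>{1..<?N}. last (fs ! (j - 1)) < hd (fs ! j) + d) \<longleftrightarrow>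
      successively (\<lambda>f g. last f < hd g + d) fs"
    unfolding shift successively_conv_nth by simp
  finally show ?thesis
    by (auto simp: run_factorization_def all_set_conv_all_nth)
qed

lemma card_ones_incidence_mat:
  assumes "subdiagonal fs" "\<forall>f\<in>set fs. sorted_wrt (>) f"
  shows "card {(i, j). i < dim_row (incidence_mat fs) \<and> j < dim_col (incidence_mat fs) \<and>
      incidence_mat fs $$ (i, j) = 1} = length (concat fs)"
proof -
  have "{(i, j). i < dim_row (incidence_mat fs) \<and> j < dim_col (incidence_mat fs) \<and>
      incidence_mat fs $$ (i, j) = 1} = prod.swap ` (SIGMA j:{..<length fs}. set (fs ! j))"
    using subdiagonal_less_length[OF assms(1)]
    by (force simp: incidence_mat_entry split: if_splits)
  then have "card {(i, j). i < dim_row (incidence_mat fs) \<and> j < dim_col (incidence_mat fs) \<and>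
      incidence_mat fs $$ (i, j) = 1} = (\<Sum>j<length fs. card (set (fs ! j)))"
    by (simp add: card_image)
  also have "\<dots> = (\<Sum>j<length fs. length (fs ! j))"
    using assms(2) by (intro sum.cong) (auto simp: distinct_card distinct_if_sorted_wrt_greater)
  also have "\<dots> = length (concat fs)"
    by (simp add: length_concat sum_list_sum_nth atLeast0LessThan)
  finally show ?thesis .
qed

text \<open>The row indices of the ones of each column are listed in decreasing order, because this is the
  order in which a factor runs through them.\<close>

definition column_lists :: "int mat \<Rightarrow> nat list list" where
  "column_lists M =
     map (\<lambda>j. rev (filter (\<lambda>i. M $$ (i, j) = 1) [0..<dim_row M])) [0..<dim_col M]"

lemma sorted_column_lists: "\<forall>f\<in>set (column_lists M). sorted_wrt (>) f"
  by (auto simp: column_lists_def sorted_wrt_rev intro!: sorted_wrt_filter)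

lemma decreasing_eq_if_set_eq:
  fixes f g :: "nat list"
  assumes "sorted_wrt (>) f" "sorted_wrt (>) g" "set f = set g"
  shows "f = g"
proof -
  have "sorted_wrt (<) (rev f)" "sorted_wrt (<) (rev g)" using assms by (auto simp: sorted_wrt_rev)
  then have "rev f = rev g" using assms(3) strict_sorted_equal by (metis set_rev)
  then show ?thesis by simp
qed

lemma column_lists_incidence_mat:
  assumes "subdiagonal fs" "\<forall>f\<in>set fs. sorted_wrt (>) f"
  shows "column_lists (incidence_mat fs) = fs"
proof (rule nth_equalityI)
  fix j assume "j < length (column_lists (incidence_mat fs))"
  then have j: "j < length fs" by (simp add: column_lists_def)
  show "column_lists (incidence_mat fs) ! j = fs ! j"
  proof (rule decreasing_eq_if_set_eq)
    show "sorted_wrt (>) (column_lists (incidence_mat fs) ! j)"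
      using sorted_column_lists[of "incidence_mat fs"] j by (simp add: column_lists_def)
    show "set (column_lists (incidence_mat fs) ! j) = set (fs ! j)"
      using j subdiagonal_less_length[OF assms(1) j]
      by (auto simp: column_lists_def incidence_mat_entry split: if_splits)
  qed (use assms j in auto)
qed (simp add: column_lists_def)

lemma d_matrix_column_lists:
  assumes "d_matrix d M"
  shows "subdiagonal (column_lists M)" "incidence_mat (column_lists M) = M"
proof -
  have sq: "dim_col M = dim_row M" and tri: "upper_triangular M"
    and ent: "\<And>i j. i < dim_row M \<Longrightarrow> j < dim_row M \<Longrightarrow> M $$ (i, j) \<in> {0, 1}"
    using assms by (auto simp: d_matrix_def)
  have "x \<le> j" if "x < dim_row M" "j < dim_row M" "M $$ (x, j) = 1" for x j
    using upper_triangularD[OF tri, of j x] that by (metis not_le zero_neq_one)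
  then show "subdiagonal (column_lists M)"
    using sq by (auto simp: subdiagonal_def column_lists_def)
  show "incidence_mat (column_lists M) = M"
    using sq ent by (intro eq_matI) (auto simp: incidence_mat_def column_lists_def)
qed

section \<open>The bijection\<close>

theorem theorem2p1:
  fixes d n :: nat
  assumes "d \<ge> 1"
  shows "bij_betw (mx d) (dA d n) (dMtx d n) \<and> card (dA d n) = card (dMtx d n)"
proof -
  have decreasing: "\<forall>f\<in>set (factors d \<alpha>). sorted_wrt (>) f" for \<alpha>
    using run_factorization_factors[of d \<alpha>] sorted_wrt_gap_greater[OF assms]
    by (auto simp: run_factorization_def)
  have "bij_betw (mx d) (dA d n) (dMtx d n)"
  proof (rule bij_betw_byWitness[where f' = "\<lambda>M. concat (column_lists M)"])
    show "\<forall>\<alpha>\<in>dA d n. concat (column_lists (mx d \<alpha>)) = \<alpha>"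
    proof
      fix \<alpha> assume "\<alpha> \<in> dA d n"
      then have sub: "subdiagonal (factors d \<alpha>)" by (simp add: dA_def dascent_seq_iff_subdiagonal)
      show "concat (column_lists (mx d \<alpha>)) = \<alpha>"
        unfolding mx_eq_incidence_mat[OF assms] column_lists_incidence_mat[OF sub decreasing]
        by simp
    qed
    show "mx d ` dA d n \<subseteq> dMtx d n"
    proof (rule image_subsetI)
      fix \<alpha> assume \<alpha>: "\<alpha> \<in> dA d n"
      then have sub: "subdiagonal (factors d \<alpha>)" by (simp add: dA_def dascent_seq_iff_subdiagonal)
      have "d_matrix d (mx d \<alpha>)"
        unfolding mx_eq_incidence_mat[OF assms]
          d_matrix_incidence_mat_iff[OF assms sub decreasing]
        by (rule run_factorization_factors)
      moreover have "length (concat (factors d \<alpha>)) = n" using \<alpha> by (simp add: dA_def)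
      ultimately show "mx d \<alpha> \<in> dMtx d n"
        using card_ones_incidence_mat[OF sub decreasing]
        by (simp only: dMtx_def mem_Collect_eq mx_eq_incidence_mat[OF assms] simp_thms)
    qed
    have inv: "factors d (concat (column_lists M)) = column_lists M"
      if M: "d_matrix d M" for M
      using d_matrix_column_lists[OF M] M sorted_column_lists
      by (metis assms d_matrix_incidence_mat_iff factors_concat)
    then show "\<forall>M\<in>dMtx d n. mx d (concat (column_lists M)) = M"
      by (auto simp: dMtx_def mx_eq_incidence_mat[OF assms] intro: d_matrix_column_lists(2))
    show "(\<lambda>M. concat (column_lists M)) ` dMtx d n \<subseteq> dA d n"
    proof (rule image_subsetI)
      fix M assume M: "M \<in> dMtx d n"
      then have dm: "d_matrix d M" by (simp add: dMtx_def)
      have "length (concat (column_lists M)) = n"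
        using card_ones_incidence_mat[OF d_matrix_column_lists(1)[OF dm] sorted_column_lists] M
        by (simp only: d_matrix_column_lists(2)[OF dm] dMtx_def mem_Collect_eq)
      then show "concat (column_lists M) \<in> dA d n"
        using d_matrix_column_lists(1)[OF dm] inv[OF dm]
        by (simp only: dA_def dascent_seq_iff_subdiagonal mem_Collect_eq simp_thms)
    qed
  qed
  then show ?thesis using bij_betw_same_card by blast
qed

end
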